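(* Let $k$ be a positive integer. Suppose $\mathcal{F}_1,\dots,\mathcal{F}_{2k}$ are finite families of compact convex sets in $\mathbb{R}^2$ such that for any choice of sets $F_i\in\mathcal{F}_i$, $i\in\{1,\dots,2k\}$, some two sets among $F_1,\dots,F_{2k}$ intersect, i.e. there exist indices $i\neq j$ with $F_i\cap F_j\neq\emptyset$. Then there exists $i\in\{1,\dots,2k\}$ such that $\mathcal{F}_i$ is pierced by $k$ lines.
   Context: A family $\mathcal{F}$ of sets in $\mathbb{R}^d$ is pierced by $k$ lines if there exist $k$ lines in $\mathbb{R}^d$ whose union intersects every set in $\mathcal{F}$. *)

theory Defs
  imports "HOL-Analysis.Analysis"
begin

definition is_line :: "'a::euclidean_space set \<Rightarrow> bool" where
  "is_line L \<longleftrightarrow> affine L \<and> aff_dim L = 1"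

text \<open>The \<open>k\<close> lines are taken to be distinct. In dimension at least two this is no
  restriction compared with allowing repetitions, since further lines can always be added.\<close>

definition pierced_by_lines :: "nat \<Rightarrow> 'a::euclidean_space set set \<Rightarrow> bool" where
  "pierced_by_lines k \<F> \<longleftrightarrow>
     (\<exists>\<L>. finite \<L> \<and> card \<L> = k \<and> (\<forall>L\<in>\<L>. is_line L) \<and> (\<forall>S\<in>\<F>. \<Union>\<L> \<inter> S \<noteq> {}))"

end

theory Submission
  imports Defs
begin

text \<open>A point \<open>p\<close> of the cube of dimension \<open>2 * k - 1\<close> encodes a horizontal line and \<open>k - 1\<close>
  lines across it, and these \<open>k\<close> lines separate \<open>2 * k\<close> disjoint convex regions: above or below
  the horizontal line, and to the left of the \<open>i\<close>-th line but to the right of the previous ones.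
  If no family is pierced by \<open>k\<close> lines, then for every \<open>p\<close> each family has a member inside some
  region. This gives \<open>2 * k\<close> open covers of the cube, and averaging partitions of unity subordinate
  to them assigns weights to the regions. The regions degenerate on the faces of the cube in such a
  way that the Poincare--Miranda theorem yields a point where all weights agree. There the
  matrix of families against regions is doubly stochastic, so Hall's theorem distributes one set of
  each family into distinct regions, contradicting the assumption.\<close>

subsection \<open>The Poincare--Miranda theorem\<close>

text \<open>The dimension \<open>2 * k - 1\<close> of the application depends on a variable, so
  points are sequences of reals. In the product topology the cube is compact by Tychonoff's
  theorem.\<close>

definition unit_cube :: "(nat \<Rightarrow> real) set" where
  "unit_cube = {x. \<forall>i. 0 \<le> x i \<and> x i \<le> 1}"

lemma compact_unit_cube: "compact unit_cube"
proof -
  have "unit_cube = PiE UNIV (\<lambda>_. {0..1})"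
    by (auto simp: unit_cube_def PiE_def Pi_def)
  moreover have "compactin (product_topology (\<lambda>_. euclidean) UNIV) (PiE UNIV (\<lambda>_. {0..1::real}))"
    by (simp add: compactin_PiE)
  ultimately show ?thesis
    by (metis compactin_euclidean_iff euclidean_product_topology)
qed

lemma tendsto_fun_iff:
  fixes f :: "'a \<Rightarrow> 'b \<Rightarrow> 'c::topological_space"
  shows "(f \<longlongrightarrow> l) F \<longleftrightarrow> (\<forall>i. ((\<lambda>a. f a i) \<longlongrightarrow> l i) F)"
proof -
  have "limitin (product_topology (\<lambda>_. euclidean) UNIV) f l F \<longleftrightarrow> (\<forall>i. limitin euclidean (\<lambda>a. f a i) (l i) F)"
    by (simp add: limitin_componentwise)
  then show ?thesis
    by (simp add: euclidean_product_topology)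
qed

text \<open>Kuhn's lemma on ever finer grids yields cells on whose vertices every \<open>h i\<close>
  takes both weak signs; along a subsequence these cells shrink to a point where all
  \<open>h i\<close> vanish.\<close>

lemma poincare_miranda:
  fixes h :: "nat \<Rightarrow> (nat \<Rightarrow> real) \<Rightarrow> real"
  assumes cont: "\<And>i. i < n \<Longrightarrow> continuous_on unit_cube (h i)"
    and lower: "\<And>i x. i < n \<Longrightarrow> x \<in> unit_cube \<Longrightarrow> x i = 0 \<Longrightarrow> h i x \<le> 0"
    and upper: "\<And>i x. i < n \<Longrightarrow> x \<in> unit_cube \<Longrightarrow> x i = 1 \<Longrightarrow> h i x \<ge> 0"
  shows "\<exists>x\<in>unit_cube. \<forall>i<n. h i x = 0"
proof -
  \<comment> \<open>Grid points of mesh \<open>1 / Suc P\<close>; the coordinates from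
    \<open>n\<close> on are frozen at 0.\<close>
  define pt :: "nat \<Rightarrow> (nat \<Rightarrow> nat) \<Rightarrow> nat \<Rightarrow> real"
    where "pt P x = (\<lambda>i. if i < n then real (x i) / real (Suc P) else 0)" for P x
  have pt_cube: "pt P x \<in> unit_cube" if "\<And>i. i < n \<Longrightarrow> x i \<le> Suc P" for P x
    using that by (auto simp: pt_def unit_cube_def divide_le_eq_1 simp del: of_nat_Suc)
  define adj where "adj q r \<longleftrightarrow> (\<forall>j<n. q j \<le> r j \<and> r j \<le> q j + 1)" for q r :: "nat \<Rightarrow> nat"
  have "\<exists>q. (\<forall>i<n. q i < Suc P) \<and>
     (\<forall>i<n. \<exists>r s. adj q r \<and> adj q s \<and> h i (pt P r) \<le> 0 \<and> h i (pt P s) \<ge> 0)" for P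
  proof -
    \<comment> \<open>Kuhn's lemma prescribes the labels at coordinates 0 and \<open>Suc P\<close>.
      The hypotheses \<open>lower\<close> and \<open>upper\<close> make these forced labels agree
      with the weak sign of \<open>h i\<close>, as \<open>lab0\<close> and \<open>lab1\<close>
      record.\<close>
    define label :: "(nat \<Rightarrow> nat) \<Rightarrow> nat \<Rightarrow> nat" where
      "label x i = (if x i = 0 then 0 else if x i = Suc P then 1 else if h i (pt P x) \<le> 0 then 0 else 1)"
      for x i
    obtain q where q: "\<forall>i<n. q i < Suc P"
      and rs: "\<forall>i<n. \<exists>r s. (\<forall>j<n. q j \<le> r j \<and> r j \<le> q j + 1) \<and> (\<forall>j<n. q j \<le> s j \<and> s j \<le> q j + 1)
        \<and> label r i \<noteq> label s i"
      by (rule kuhn_lemma[of "Suc P" n label]) (auto simp: label_def)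
    have bound: "x i \<le> Suc P" if "adj q x" "i < n" for x i
    proof -
      have "x i \<le> q i + 1" "q i < Suc P"
        using that q by (simp_all add: adj_def)
      then show ?thesis by linarith
    qed
    have in_cube: "pt P x \<in> unit_cube" if "adj q x" for x
      using bound[OF that] by (rule pt_cube)
    have lab0: "h i (pt P x) \<le> 0" if "label x i = 0" "i < n" "adj q x" for x i
      using that lower[of i "pt P x"] in_cube[of x]
      by (auto simp: label_def pt_def split: if_splits)
    have lab1: "h i (pt P x) \<ge> 0" if "label x i \<noteq> 0" "i < n" "adj q x" for x i
      using that upper[of i "pt P x"] in_cube[of x]
      by (auto simp: label_def pt_def split: if_splits)
    have "\<exists>r s. adj q r \<and> adj q s \<and> h i (pt P r) \<le> 0 \<and> h i (pt P s) \<ge> 0" if "i < n" for i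
    proof -
      have "\<exists>r s. adj q r \<and> adj q s \<and> label r i \<noteq> label s i"
        unfolding adj_def using rs \<open>i < n\<close> by (elim allE impE)
      then obtain r s where "adj q r" "adj q s" "label r i \<noteq> label s i"
        by blast
      moreover from this have "label r i = 0 \<and> label s i \<noteq> 0 \<or> label s i = 0 \<and> label r i \<noteq> 0"
        by (auto simp: label_def split: if_splits)
      ultimately show ?thesis
        using lab0 lab1 \<open>i < n\<close> by metis
    qed
    then show ?thesis using q by blast
  qed
  then obtain Q where Q: "\<And>P i. i < n \<Longrightarrow> Q P i < Suc P"
    and ex: "\<And>P i. i < n \<Longrightarrow> \<exists>r s. adj (Q P) r \<and> adj (Q P) s \<and> h i (pt P r) \<le> 0 \<and> h i (pt P s) \<ge> 0"
    by metis
  \<comment> \<open>Both vertices are packed into one pair, so that a single choice depending on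
    \<open>P\<close> and \<open>i\<close> provides them together.\<close>
  have "\<forall>P i. \<exists>rs. i < n \<longrightarrow> adj (Q P) (fst rs) \<and> adj (Q P) (snd rs) \<and>
      h i (pt P (fst rs)) \<le> 0 \<and> h i (pt P (snd rs)) \<ge> 0"
    using ex by (metis fst_conv snd_conv)
  then obtain RS where "\<forall>P i. i < n \<longrightarrow> adj (Q P) (fst (RS P i)) \<and> adj (Q P) (snd (RS P i)) \<and>
      h i (pt P (fst (RS P i))) \<le> 0 \<and> h i (pt P (snd (RS P i))) \<ge> 0"
    unfolding choice_iff by blast
  then obtain R S where
    R: "\<And>P i. i < n \<Longrightarrow> adj (Q P) (R P i)" and
    S: "\<And>P i. i < n \<Longrightarrow> adj (Q P) (S P i)" and
    hR: "\<And>P i. i < n \<Longrightarrow> h i (pt P (R P i)) \<le> 0" and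
    hS: "\<And>P i. i < n \<Longrightarrow> h i (pt P (S P i)) \<ge> 0"
    using that[of "\<lambda>P i. fst (RS P i)" "\<lambda>P i. snd (RS P i)"] by blast
  have "\<forall>P. pt P (Q P) \<in> unit_cube"
    using Q by (simp add: less_imp_le pt_cube)
  moreover have "seq_compact unit_cube"
    using compact_unit_cube compact_eq_seq_compact_metric by blast
  ultimately obtain z \<sigma> where z: "z \<in> unit_cube" and \<sigma>: "strict_mono \<sigma>"
    and lim: "((\<lambda>P. pt P (Q P)) \<circ> \<sigma>) \<longlonglongrightarrow> z"
    using seq_compactE[of unit_cube "\<lambda>P. pt P (Q P)"] by metis
  \<comment> \<open>Any vertex of the cell at \<open>Q P\<close> differs from its corner by at most
    one mesh width in each coordinate, so all choices of vertices share the limit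
    \<open>z\<close>.\<close>
  have near: "(\<lambda>m. pt (\<sigma> m) (T (\<sigma> m))) \<longlonglongrightarrow> z"
    if T: "\<And>P. adj (Q P) (T P)" for T
    unfolding tendsto_fun_iff
  proof
    fix j
    have inv: "(\<lambda>P. inverse (real (Suc (\<sigma> P)))) \<longlonglongrightarrow> 0"
      using LIMSEQ_subseq_LIMSEQ[OF LIMSEQ_inverse_real_of_nat \<sigma>] by (simp add: o_def)
    have "norm (pt P (T P) j - pt P (Q P) j) \<le> inverse (real (Suc P))" for P
    proof (cases "j < n")
      case True
      have "\<bar>real (T P j) - real (Q P j)\<bar> \<le> 1"
        using T[of P] True unfolding adj_def by force
      moreover have "pt P (T P) j - pt P (Q P) j = (real (T P j) - real (Q P j)) * inverse (real (Suc P))"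
        using True by (simp add: pt_def divide_inverse left_diff_distrib del: of_nat_Suc)
      ultimately show ?thesis
        by (simp add: abs_mult mult_left_le_one_le del: of_nat_Suc inverse_positive_iff_positive)
    qed (simp add: pt_def)
    then have "norm (pt (\<sigma> m) (T (\<sigma> m)) j - pt (\<sigma> m) (Q (\<sigma> m)) j) \<le> inverse (real (Suc (\<sigma> m)))" for m .
    then have "(\<lambda>m. pt (\<sigma> m) (T (\<sigma> m)) j - pt (\<sigma> m) (Q (\<sigma> m)) j) \<longlonglongrightarrow> 0"
      by (rule Lim_null_comparison[OF always_eventually[OF allI] inv])
    moreover have "(\<lambda>m. pt (\<sigma> m) (Q (\<sigma> m)) j) \<longlonglongrightarrow> z j"
      using lim by (simp add: tendsto_fun_iff o_def)
    ultimately have "(\<lambda>m. (pt (\<sigma> m) (T (\<sigma> m)) j - pt (\<sigma> m) (Q (\<sigma> m)) j) + pt (\<sigma> m) (Q (\<sigma> m)) j)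
        \<longlonglongrightarrow> 0 + z j"
      by (intro tendsto_add)
    then show "(\<lambda>m. pt (\<sigma> m) (T (\<sigma> m)) j) \<longlonglongrightarrow> z j"
      by simp
  qed
  have in_cube: "pt P x \<in> unit_cube" if "adj (Q P) x" for P x
  proof (rule pt_cube)
    fix i assume "i < n"
    then have "x i \<le> Q P i + 1" "Q P i < Suc P"
      using that Q by (simp_all add: adj_def)
    then show "x i \<le> Suc P" by linarith
  qed
  have "h i z = 0" if i: "i < n" for i
  proof (rule antisym)
    have "(\<lambda>m. h i (pt (\<sigma> m) (R (\<sigma> m) i))) \<longlonglongrightarrow> h i z"
      by (intro continuous_on_tendsto_compose[OF cont[OF i]] near[of "\<lambda>P. R P i"] z
          always_eventually allI in_cube R[OF i])
    then show "h i z \<le> 0"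
      using hR[OF i] by (intro LIMSEQ_le_const2) auto
    have "(\<lambda>m. h i (pt (\<sigma> m) (S (\<sigma> m) i))) \<longlonglongrightarrow> h i z"
      by (intro continuous_on_tendsto_compose[OF cont[OF i]] near[of "\<lambda>P. S P i"] z
          always_eventually allI in_cube S[OF i])
    then show "0 \<le> h i z"
      using hS[OF i] by (intro LIMSEQ_le_const) auto
  qed
  then show ?thesis using z by blast
qed

subsection \<open>Systems of distinct representatives\<close>

text \<open>Hall's theorem by the Halmos-Vaughan induction: split along a proper nonempty subset
  where the condition is tight, or, if there is none, fix one representative arbitrarily.\<close>

lemma hall_marriage:
  assumes "finite I" and "\<And>i. i \<in> I \<Longrightarrow> finite (N i)"
    and "\<And>J. J \<subseteq> I \<Longrightarrow> card J \<le> card (\<Union>(N ` J))"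
  shows "\<exists>f. inj_on f I \<and> (\<forall>i\<in>I. f i \<in> N i)"
  using assms
proof (induction I arbitrary: N rule: finite_psubset_induct)
  case (psubset I)
  note fin = \<open>finite I\<close> and finN = psubset.prems(1) and hall = psubset.prems(2)
  have finU: "finite (\<Union>(N ` J))" if "J \<subseteq> I" for J
    using that fin finN by (meson finite_UN finite_subset subsetD)
  show ?case
  proof (cases "\<exists>J. J \<noteq> {} \<and> J \<subset> I \<and> card J = card (\<Union>(N ` J))")
    case True
    then obtain J where J: "J \<noteq> {}" "J \<subset> I" and tight: "card J = card (\<Union>(N ` J))"
      by blast
    define U where "U = \<Union>(N ` J)"
    obtain f where f: "inj_on f J" "\<forall>i\<in>J. f i \<in> N i"
      using psubset.IH[of J N] J finN hall by (meson psubset_imp_subset subset_trans subsetD)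
    \<comment> \<open>Hall's condition survives the removal of \<open>U\<close>: apply it to
      \<open>J \<union> K\<close> and subtract the equality for \<open>J\<close>.\<close>
    have "card K \<le> card (\<Union>((\<lambda>i. N i - U) ` K))" if K: "K \<subseteq> I - J" for K
    proof -
      have "card J + card K = card (J \<union> K)"
        using K J fin by (intro card_Un_disjoint[symmetric]) (auto intro: finite_subset)
      also have "\<dots> \<le> card (\<Union>(N ` (J \<union> K)))"
        using hall[of "J \<union> K"] K J by blast
      also have "\<Union>(N ` (J \<union> K)) = U \<union> \<Union>((\<lambda>i. N i - U) ` K)"
        by (auto simp: U_def)
      also have "card \<dots> \<le> card U + card (\<Union>((\<lambda>i. N i - U) ` K))"
        by (rule card_Un_le)
      finally show ?thesis
        using tight by (simp add: U_def)
    qed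
    moreover have "I - J \<subset> I"
      using J by blast
    ultimately obtain g where g: "inj_on g (I - J)" "\<forall>i\<in>I - J. g i \<in> N i - U"
      using psubset.IH[of "I - J" "\<lambda>i. N i - U"] finN by blast
    define e where "e = (\<lambda>i. if i \<in> J then f i else g i)"
    have "inj_on e I"
    proof -
      have "f ` J \<inter> g ` (I - J) = {}"
        using f g by (force simp: U_def)
      then have "inj_on e (J \<union> (I - J))"
        using f g by (intro inj_on_disjoint_Un[of f J g "I - J", folded e_def])
      then show ?thesis
        using J by (simp add: Un_absorb1 psubset_imp_subset)
    qed
    moreover have "\<forall>i\<in>I. e i \<in> N i"
      using f g by (auto simp: e_def)
    ultimately show ?thesis by blast
  next
    case loose: False
    show ?thesis
    proof (cases "I = {}")
      case False
      then obtain i where i: "i \<in> I" by blast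
      have "card {i} \<le> card (N i)"
        using hall[of "{i}"] i by simp
      then obtain x where x: "x \<in> N i"
        by fastforce
      \<comment> \<open>Without tight subsets, each nonempty proper \<open>K\<close> has at least
        one neighbour to spare, so losing \<open>x\<close> is harmless.\<close>
      have "card K \<le> card (\<Union>((\<lambda>j. N j - {x}) ` K))" if K: "K \<subseteq> I - {i}" for K
      proof (cases "K = {}")
        case False
        moreover have "K \<subset> I"
          using K i by blast
        ultimately have "card K < card (\<Union>(N ` K))"
          using loose hall[of K] by (meson le_neq_implies_less psubset_imp_subset)
        moreover have "\<Union>((\<lambda>j. N j - {x}) ` K) = \<Union>(N ` K) - {x}"
          by auto
        ultimately show ?thesis
          using finU[of K] K by (auto simp: card_Diff_singleton_if)
      qed simp
      moreover have "I - {i} \<subset> I"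
        using i by blast
      ultimately obtain g where g: "inj_on g (I - {i})" "\<forall>j\<in>I - {i}. g j \<in> N j - {x}"
        using psubset.IH[of "I - {i}" "\<lambda>j. N j - {x}"] finN by blast
      have "x \<notin> g ` (I - {i})"
        using g by blast
      then have "inj_on (g(i := x)) (insert i (I - {i}))"
        using g unfolding inj_on_insert by (auto intro: inj_on_fun_updI)
      then have "inj_on (g(i := x)) I"
        using i by (simp add: insert_absorb)
      moreover have "\<forall>j\<in>I. (g(i := x)) j \<in> N j"
        using g x by auto
      ultimately show ?thesis by blast
    qed simp
  qed
qed

text \<open>Rows in \<open>J\<close> have total weight \<open>card J\<close>, carried by the columns
  where one of them is positive. Each column holds at most 1, so there are at least
  \<open>card J\<close> such columns, which is Hall's condition.\<close>

lemma doubly_stochastic_permutation: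
  fixes w :: "'a \<Rightarrow> 'b \<Rightarrow> real"
  assumes "finite I" "finite R"
    and nonneg: "\<And>i r. i \<in> I \<Longrightarrow> r \<in> R \<Longrightarrow> 0 \<le> w i r"
    and rows: "\<And>i. i \<in> I \<Longrightarrow> (\<Sum>r\<in>R. w i r) = 1"
    and cols: "\<And>r. r \<in> R \<Longrightarrow> (\<Sum>i\<in>I. w i r) = 1"
  shows "\<exists>f. inj_on f I \<and> (\<forall>i\<in>I. f i \<in> R \<and> w i (f i) > 0)"
proof -
  define N where "N i = {r\<in>R. w i r > 0}" for i
  have "card J \<le> card (\<Union>(N ` J))" if J: "J \<subseteq> I" for J
  proof -
    have "real (card J) = (\<Sum>i\<in>J. \<Sum>r\<in>R. w i r)"
      using rows J by (simp add: subset_iff)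
    also have "\<dots> = (\<Sum>i\<in>J. \<Sum>r\<in>\<Union>(N ` J). w i r)"
    proof (rule sum.cong[OF refl])
      fix i assume i: "i \<in> J"
      have "w i r = 0" if "r \<in> R - \<Union>(N ` J)" for r
        using nonneg[of i r] J i that by (fastforce simp: N_def)
      then show "(\<Sum>r\<in>R. w i r) = (\<Sum>r\<in>\<Union>(N ` J). w i r)"
        using \<open>finite R\<close> by (intro sum.mono_neutral_right) (auto simp: N_def)
    qed
    also have "\<dots> = (\<Sum>r\<in>\<Union>(N ` J). \<Sum>i\<in>J. w i r)"
      by (rule sum.swap)
    also have "\<dots> \<le> (\<Sum>r\<in>\<Union>(N ` J). \<Sum>i\<in>I. w i r)"
      using nonneg J \<open>finite I\<close> by (intro sum_mono sum_mono2) (auto simp: N_def)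
    also have "\<dots> = (\<Sum>r\<in>\<Union>(N ` J). 1)"
      using cols by (intro sum.cong) (auto simp: N_def)
    finally show ?thesis by simp
  qed
  then show ?thesis
    using hall_marriage[of I N] \<open>finite I\<close> \<open>finite R\<close> by (auto simp: N_def)
qed

subsection \<open>Rainbow covers of the cube\<close>

text \<open>The distance to the complement works unless the complement is empty, where
  \<open>infdist\<close> is constantly 0; the constant 1 replaces it there.\<close>

lemma open_positivity_function:
  fixes A :: "'a::metric_space set"
  assumes "open A"
  shows "\<exists>w::'a \<Rightarrow> real. continuous_on UNIV w \<and> (\<forall>x. 0 \<le> w x \<and> (0 < w x \<longleftrightarrow> x \<in> A))"
proof (cases "A = UNIV")
  case True
  then show ?thesis
    by (intro exI[of _ "\<lambda>_. 1"]) auto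
next
  case False
  then have "- A \<noteq> {}"
    by auto
  then have "(0 < infdist x (- A)) \<longleftrightarrow> x \<in> A" for x
    using in_closed_iff_infdist_zero[of "- A" x] assms infdist_nonneg[of x "- A"]
    by (simp add: closed_Compl less_le) blast
  then show ?thesis
    by (intro exI[of _ "\<lambda>x. infdist x (- A)"]) (auto intro!: continuous_intros infdist_nonneg)
qed

text \<open>Making the \<open>2 * k\<close> column sums \<open>g r\<close> equal takes
  \<open>2 * k - 1\<close> equations, one for each coordinate with face conditions. These conditions
  make weights vanish on faces and thereby supply the signs for Poincare-Miranda.\<close>

lemma rainbow_cover_unit_cube:
  fixes A :: "nat \<Rightarrow> nat \<Rightarrow> (nat \<Rightarrow> real) set"
  assumes k: "k \<ge> 1"
    and op: "\<And>j r. j < 2 * k \<Longrightarrow> r < 2 * k \<Longrightarrow> open (A j r)"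
    and cover: "\<And>j p. j < 2 * k \<Longrightarrow> p \<in> unit_cube \<Longrightarrow> \<exists>r<2 * k. p \<in> A j r"
    and face0: "\<And>j r p. j < 2 * k \<Longrightarrow> r < 2 * k - 2 \<Longrightarrow> p \<in> unit_cube \<Longrightarrow> p r = 0 \<Longrightarrow> p \<notin> A j r"
    and face1: "\<And>j r m p. j < 2 * k \<Longrightarrow> r < 2 * k - 2 \<Longrightarrow> p \<in> unit_cube \<Longrightarrow> p r = 1 \<Longrightarrow>
        r < m \<Longrightarrow> m < 2 * k \<Longrightarrow> even m = even r \<Longrightarrow> p \<notin> A j m"
    and last0: "\<And>j r p. j < 2 * k \<Longrightarrow> r < 2 * k \<Longrightarrow> p \<in> unit_cube \<Longrightarrow> p (2 * k - 2) = 0 \<Longrightarrow>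
        odd r \<Longrightarrow> p \<notin> A j r"
    and last1: "\<And>j r p. j < 2 * k \<Longrightarrow> r < 2 * k \<Longrightarrow> p \<in> unit_cube \<Longrightarrow> p (2 * k - 2) = 1 \<Longrightarrow>
        even r \<Longrightarrow> p \<notin> A j r"
  shows "\<exists>p\<in>unit_cube. \<exists>\<pi>. inj_on \<pi> {..<2 * k} \<and> (\<forall>j<2 * k. \<pi> j < 2 * k \<and> p \<in> A j (\<pi> j))"
proof -
  have "\<forall>j r. \<exists>w. j < 2 * k \<longrightarrow> r < 2 * k \<longrightarrow>
      continuous_on UNIV w \<and> (\<forall>p. (0::real) \<le> w p \<and> (0 < w p \<longleftrightarrow> p \<in> A j r))"
    using open_positivity_function[OF op] by meson
  then obtain w :: "nat \<Rightarrow> nat \<Rightarrow> (nat \<Rightarrow> real) \<Rightarrow> real"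
    where w_cont: "\<And>j r. j < 2 * k \<Longrightarrow> r < 2 * k \<Longrightarrow> continuous_on UNIV (w j r)"
      and w_nonneg: "\<And>j r p. j < 2 * k \<Longrightarrow> r < 2 * k \<Longrightarrow> 0 \<le> w j r p"
      and w_pos: "\<And>j r p. j < 2 * k \<Longrightarrow> r < 2 * k \<Longrightarrow> 0 < w j r p \<longleftrightarrow> p \<in> A j r"
    by metis
  \<comment> \<open>For each family \<open>j\<close> a partition of unity on the cube. Elsewhere the
    denominator may be 0, but division by zero gives 0, so nonnegativity holds at every
    point.\<close>
  define \<phi> where "\<phi> j r p = w j r p / (\<Sum>s<2 * k. w j s p)" for j r p
  define g where "g r p = (\<Sum>j<2 * k. \<phi> j r p)" for r p
  have tot: "(\<Sum>s<2 * k. w j s p) > 0" if "j < 2 * k" "p \<in> unit_cube" for j p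
  proof -
    obtain r where "r < 2 * k" "p \<in> A j r"
      using cover \<open>p \<in> unit_cube\<close> \<open>j < 2 * k\<close> by blast
    then show ?thesis
      using w_pos w_nonneg \<open>j < 2 * k\<close> by (intro sum_pos2[of _ r]) auto
  qed
  have g_cont: "continuous_on unit_cube (g r)" if "r < 2 * k" for r
    unfolding g_def \<phi>_def using tot that
    by (intro continuous_intros continuous_on_subset[OF w_cont subset_UNIV]) force+
  have \<phi>_nonneg: "0 \<le> \<phi> j r p" if "j < 2 * k" "r < 2 * k" for j r p
    unfolding \<phi>_def using that w_nonneg by (intro divide_nonneg_nonneg sum_nonneg) auto
  have g_nonneg: "0 \<le> g r p" if "r < 2 * k" for r p
    unfolding g_def using that \<phi>_nonneg by (intro sum_nonneg) auto
  have g_zero: "g r p = 0" if "r < 2 * k" "\<And>j. j < 2 * k \<Longrightarrow> p \<notin> A j r" for r p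
  proof -
    have "w j r p = 0" if "j < 2 * k" for j
      using w_pos[of j r p] w_nonneg[of j r p] that \<open>r < 2 * k\<close> \<open>\<And>j. j < 2 * k \<Longrightarrow> p \<notin> A j r\<close>
      by force
    then show ?thesis by (simp add: g_def \<phi>_def)
  qed
  define T where "T r = {m. r < m \<and> m < 2 * k \<and> even m = even r}" for r
  define Ev where "Ev = {m. m < 2 * k \<and> even m}"
  define Od where "Od = {m. m < 2 * k \<and> odd m}"
  have fin [simp]: "finite (T r)" "finite Ev" "finite Od" for r
    by (simp_all add: T_def Ev_def Od_def)
  \<comment> \<open>Below \<open>2 * k - 2\<close>, \<open>g r\<close> competes with the later
    weights of its parity: it vanishes at \<open>p r = 0\<close>, they vanish at
    \<open>p r = 1\<close>. The last coordinate balances the two parities.\<close>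
  define h where "h r p = (if r < 2 * k - 2 then \<Sum>m\<in>T r. g r p - g m p
      else (\<Sum>m\<in>Od. g m p) - (\<Sum>m\<in>Ev. g m p))" for r p
  have "\<exists>p\<in>unit_cube. \<forall>r<2 * k - 1. h r p = 0"
  proof (rule poincare_miranda)
    show "continuous_on unit_cube (h r)" if "r < 2 * k - 1" for r
      unfolding h_def using that
      by (cases "r < 2 * k - 2")
        (auto intro!: continuous_intros g_cont simp: T_def Ev_def Od_def)
    show "h r p \<le> 0" if r: "r < 2 * k - 1" and p: "p \<in> unit_cube" "p r = 0" for r p
    proof (cases "r < 2 * k - 2")
      case True
      have "g r p = 0"
        using True p face0 by (intro g_zero) auto
      then show ?thesis
        using True g_nonneg by (auto simp: h_def T_def intro!: sum_nonpos)
    next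
      case False
      then have "r = 2 * k - 2"
        using r by linarith
      then have "(\<Sum>m\<in>Od. g m p) = 0"
        using p last0 by (intro sum.neutral ballI g_zero) (auto simp: Od_def)
      then show ?thesis
        using False g_nonneg by (auto simp: h_def Ev_def intro!: sum_nonneg)
    qed
    show "h r p \<ge> 0" if r: "r < 2 * k - 1" and p: "p \<in> unit_cube" "p r = 1" for r p
    proof (cases "r < 2 * k - 2")
      case True
      have "g m p = 0" if "m \<in> T r" for m
        using True p face1[of _ r p m] that by (intro g_zero) (auto simp: T_def)
      then show ?thesis
        using True g_nonneg by (auto simp: h_def T_def intro!: sum_nonneg)
    next
      case False
      then have "r = 2 * k - 2"
        using r by linarith
      then have "(\<Sum>m\<in>Ev. g m p) = 0"
        using p last1 by (intro sum.neutral ballI g_zero) (auto simp: Ev_def)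
      then show ?thesis
        using False g_nonneg by (auto simp: h_def Od_def intro!: sum_nonneg)
    qed
  qed
  then obtain p where p: "p \<in> unit_cube" and h0: "\<And>r. r < 2 * k - 1 \<Longrightarrow> h r p = 0"
    by blast
  \<comment> \<open>Downward induction: all indices in \<open>T r\<close> already have the weight of
    the last index of their parity, so \<open>h r p = 0\<close> forces \<open>g r p\<close> to equal
    it too.\<close>
  have g_last: "g r p = g (2 * k - 2 + r mod 2) p" if "r < 2 * k" for r
    using that
  proof (induction "2 * k - r" arbitrary: r rule: less_induct)
    case less
    show ?case
    proof (cases "r < 2 * k - 2")
      case True
      have l: "2 * k - 2 + r mod 2 \<in> T r"
        using True k unfolding T_def by (auto simp: parity_cases)
      have "0 = (\<Sum>m\<in>T r. g r p - g m p)"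
        using h0[of r] True by (simp add: h_def)
      also have "\<dots> = (\<Sum>m\<in>T r. g r p - g (2 * k - 2 + r mod 2) p)"
      proof (rule sum.cong[OF refl])
        fix m assume m: "m \<in> T r"
        then have "g m p = g (2 * k - 2 + m mod 2) p"
          by (intro less.hyps) (auto simp: T_def)
        moreover have "m mod 2 = r mod 2"
          using m by (simp add: T_def) presburger
        ultimately show "g r p - g m p = g r p - g (2 * k - 2 + r mod 2) p"
          by simp
      qed
      also have "\<dots> = card (T r) * (g r p - g (2 * k - 2 + r mod 2) p)"
        by simp
      finally show ?thesis
        using l by (auto simp: card_gt_0_iff)
    next
      case False
      then have "r = 2 * k - 2 + r mod 2"
        using less.prems k by presburger
      then show ?thesis by simp
    qed
  qed
  have "bij_betw Suc Ev Od"
    unfolding bij_betw_def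
  proof
    show "Suc ` Ev = Od"
      by (auto simp: Ev_def Od_def image_iff elim!: oddE)
  qed simp
  then have card_eq: "card Od = card Ev"
    by (rule bij_betw_same_card[symmetric])
  have "0 \<in> Ev"
    using k by (simp add: Ev_def)
  then have card_pos: "card Ev > 0"
    by (auto simp: card_gt_0_iff)
  have ev: "g m p = g (2 * k - 2) p" if "m \<in> Ev" for m
    using g_last[of m] that by (simp add: Ev_def even_iff_mod_2_eq_zero)
  have od: "g m p = g (2 * k - 1) p" if "m \<in> Od" for m
  proof -
    have "2 * k - 2 + m mod 2 = 2 * k - 1"
      using k that unfolding Od_def by (simp only: mem_Collect_eq) presburger
    then show ?thesis
      using g_last[of m] that by (simp add: Od_def)
  qed
  have "(\<Sum>m\<in>Ev. g m p) = card Ev * g (2 * k - 2) p"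
    using sum.cong[OF refl ev] by simp
  moreover have "(\<Sum>m\<in>Od. g m p) = card Od * g (2 * k - 1) p"
    using sum.cong[OF refl od] by simp
  moreover have "h (2 * k - 2) p = 0"
    using k by (intro h0) linarith
  ultimately have g_eq: "g (2 * k - 1) p = g (2 * k - 2) p"
    using card_pos card_eq by (auto simp: h_def)
  have g_all: "g r p = g (2 * k - 2) p" if "r < 2 * k" for r
    using ev[of r] od[of r] g_eq that unfolding Ev_def Od_def by force
  have rows: "(\<Sum>r<2 * k. \<phi> j r p) = 1" if "j < 2 * k" for j
    using tot[OF that p] by (simp add: \<phi>_def flip: sum_divide_distrib)
  \<comment> \<open>Counting the total weight by rows and by columns fixes the common column sum as
    1.\<close>
  have "real (2 * k) = (\<Sum>j<2 * k. \<Sum>r<2 * k. \<phi> j r p)"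
    using rows by simp
  also have "\<dots> = (\<Sum>r<2 * k. g r p)"
    unfolding g_def by (rule sum.swap)
  also have "\<dots> = real (2 * k) * g (2 * k - 2) p"
    using sum.cong[of "{..<2 * k}" _ "\<lambda>r. g r p", OF refl g_all] by simp
  finally have "g (2 * k - 2) p = 1"
    using k by simp
  then have cols: "(\<Sum>j<2 * k. \<phi> j r p) = 1" if "r < 2 * k" for r
    using g_all[OF that] by (metis g_def)
  obtain \<pi> where "inj_on \<pi> {..<2 * k}" "\<forall>j\<in>{..<2 * k}. \<pi> j \<in> {..<2 * k} \<and> 0 < \<phi> j (\<pi> j) p"
    using doubly_stochastic_permutation[of "{..<2 * k}" "{..<2 * k}" "\<lambda>j r. \<phi> j r p"]
      \<phi>_nonneg rows cols by auto
  moreover have "p \<in> A j r" if "0 < \<phi> j r p" "j < 2 * k" "r < 2 * k" for j r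
    using that tot[OF \<open>j < 2 * k\<close> p] w_pos by (simp add: \<phi>_def zero_less_divide_iff)
  ultimately show ?thesis
    using p by (intro bexI[of _ p] exI[of _ \<pi>]) auto
qed

subsection \<open>Lines and regions in the plane\<close>

lemma is_line_plane:
  fixes \<alpha> \<beta> c :: real
  assumes "\<alpha> \<noteq> 0 \<or> \<beta> \<noteq> 0"
  shows "is_line {x::real^2. \<alpha> * x$1 + \<beta> * x$2 = c}"
proof -
  define v :: "real^2" where "v = vector [\<alpha>, \<beta>]"
  have "{x::real^2. \<alpha> * x$1 + \<beta> * x$2 = c} = {x. v \<bullet> x = c}"
    by (simp add: v_def inner_vec_def sum_2)
  moreover have "v \<noteq> 0"
    using assms by (auto simp: v_def vec_eq_iff forall_2)
  ultimately show ?thesis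
    by (simp add: is_line_def affine_hyperplane)
qed

text \<open>Since \<open>pierced_by_lines\<close> asks for exactly \<open>k\<close> distinct lines,
  the missing ones are taken from the infinite supply of vertical lines.\<close>

lemma pierced_by_at_most_lines:
  fixes \<G> :: "(real^2) set set"
  assumes "finite \<L>" "card \<L> \<le> k" "\<And>L. L \<in> \<L> \<Longrightarrow> is_line L" "\<And>S. S \<in> \<G> \<Longrightarrow> \<Union>\<L> \<inter> S \<noteq> {}"
  shows "pierced_by_lines k \<G>"
proof -
  define V where "V = range (\<lambda>c::real. {x::real^2. x$1 = c})"
  have "inj (\<lambda>c::real. {x::real^2. x$1 = c})"
  proof (rule injI)
    fix c d :: real
    assume "{x::real^2. x$1 = c} = {x. x$1 = d}"
    moreover have "vec c \<in> {x::real^2. x$1 = c}"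
      by simp
    ultimately have "vec c \<in> {x::real^2. x$1 = d}"
      by (rule subst)
    then show "c = d" by simp
  qed
  then have "infinite V"
    by (simp add: V_def finite_image_iff infinite_UNIV_char_0)
  then obtain K where K: "finite K" "card K = k - card \<L>" "K \<subseteq> V - \<L>"
    using infinite_arbitrarily_large[of "V - \<L>"] \<open>finite \<L>\<close> by (metis Diff_infinite_finite)
  have "is_line L" if "L \<in> V" for L
    using that is_line_plane[of 1 0] by (auto simp: V_def)
  then have "\<forall>L\<in>\<L> \<union> K. is_line L"
    using K assms(3) by blast
  moreover have "card (\<L> \<union> K) = k"
    using K assms by (subst card_Un_disjoint) auto
  moreover have "\<forall>S\<in>\<G>. \<Union>(\<L> \<union> K) \<inter> S \<noteq> {}"
    using assms(4) by blast
  ultimately show ?thesis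
    unfolding pierced_by_lines_def using K(1) assms(1) by (metis finite_Un)
qed

lemma convex_nonzero_sign:
  fixes f :: "'a::real_normed_vector \<Rightarrow> real"
  assumes "convex S" "continuous_on S f" "\<And>x. x \<in> S \<Longrightarrow> f x \<noteq> 0"
  shows "(\<forall>x\<in>S. f x < 0) \<or> (\<forall>x\<in>S. f x > 0)"
proof (rule ccontr)
  assume "\<not> ?thesis"
  then obtain x y where xy: "x \<in> S" "y \<in> S" "f x \<ge> 0" "f y \<le> 0"
    by force
  have "connected (f ` S)"
    using assms convex_connected connected_continuous_image by blast
  then have "0 \<in> f ` S"
    using xy by (meson connectedD_interval imageI)
  then show False
    using assms(3) by force
qed

text \<open>With \<open>(a, b) = (p (2 * i), p (2 * i + 1))\<close>, the functional \<open>crossing\<close> interpolates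
  bilinearly between \<open>x + M\<close>, \<open>- height\<close>, \<open>height\<close> and \<open>x - M\<close> at the corners \<open>(0,0)\<close>, \<open>(1,0)\<close>,
  \<open>(0,1)\<close>, \<open>(1,1)\<close> of the unit square. Thus on the square of half-width \<open>M\<close> it is nonnegative on
  the upper (lower) part when \<open>a = 0\<close> (\<open>b = 0\<close>) and nonpositive there when \<open>a = 1\<close> (\<open>b = 1\<close>),
  while its linear part never vanishes.\<close>

definition height :: "nat \<Rightarrow> real \<Rightarrow> (nat \<Rightarrow> real) \<Rightarrow> real^2 \<Rightarrow> real" where
  "height k M p x = x$2 - M * (2 * p (2 * k - 2) - 1)"

definition crossing :: "nat \<Rightarrow> real \<Rightarrow> (nat \<Rightarrow> real) \<Rightarrow> nat \<Rightarrow> real^2 \<Rightarrow> real" where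
  "crossing k M p i x = (let a = p (2 * i); b = p (2 * i + 1) in
     ((1 - a) * (1 - b) + a * b) * x$1 + (b - a) * height k M p x + M * (1 - a - b))"

text \<open>The parity of \<open>r\<close> selects the side of the horizontal line, and
  \<open>r div 2\<close> the first crossing line with the region on its negative side; the value
  \<open>k - 1\<close> means that there is none. Recording the first such line keeps regions
  disjoint however the lines meet.\<close>

definition region :: "nat \<Rightarrow> real \<Rightarrow> (nat \<Rightarrow> real) \<Rightarrow> nat \<Rightarrow> (real^2) set" where
  "region k M p r = {x. (if even r then height k M p x > 0 else height k M p x < 0) \<and>
     (\<forall>m<r div 2. crossing k M p m x > 0) \<and> (r div 2 < k - 1 \<longrightarrow> crossing k M p (r div 2) x < 0)}"

lemma is_line_height: "is_line {x. height k M p x = 0}"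
proof -
  have "{x. height k M p x = 0} = {x. 0 * x$1 + 1 * x$2 = M * (2 * p (2 * k - 2) - 1)}"
    by (simp add: height_def)
  then show ?thesis
    using is_line_plane[of 0 1] by simp
qed

lemma is_line_crossing: "is_line {x. crossing k M p i x = 0}"
proof -
  define a b where "a = p (2 * i)" and "b = p (2 * i + 1)"
  define c where "c = (b - a) * (M * (2 * p (2 * k - 2) - 1)) - M * (1 - a - b)"
  \<comment> \<open>When the coefficient \<open>b - a\<close> vanishes, the other one is a sum of
    squares of \<open>1 - a\<close> and \<open>a\<close>, which cannot both be 0.\<close>
  have "(1 - a) * (1 - b) + a * b \<noteq> 0 \<or> b - a \<noteq> 0"
  proof (cases "a = b")
    case True
    have "(1 - a) * (1 - b) + a * b = (1 - a)\<^sup>2 + a\<^sup>2"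
      using True by (simp add: power2_eq_square)
    also have "\<dots> \<noteq> 0"
      by (auto simp: sum_power2_eq_zero_iff)
    finally show ?thesis ..
  qed simp
  moreover have "crossing k M p i x = 0 \<longleftrightarrow> ((1 - a) * (1 - b) + a * b) * x$1 + (b - a) * x$2 = c" for x
    unfolding crossing_def height_def Let_def c_def a_def[symmetric] b_def[symmetric]
    by (auto simp: algebra_simps)
  ultimately show ?thesis
    using is_line_plane by simp
qed

lemma disjoint_regions:
  assumes "r < 2 * k" "s < 2 * k" "r \<noteq> s"
  shows "region k M p r \<inter> region k M p s = {}"
proof -
  have "region k M p r \<inter> region k M p s = {}" if "r < s" "s < 2 * k" for r s
  proof (cases "even r = even s")
    case True
    then have "r div 2 < s div 2" "r div 2 < k - 1"
      using that by presburger+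
    then have "crossing k M p (r div 2) x < 0" if "x \<in> region k M p r" for x
      using that by (simp add: region_def)
    moreover have "crossing k M p (r div 2) x > 0" if "x \<in> region k M p s" for x
      using that \<open>r div 2 < s div 2\<close> by (simp add: region_def)
    ultimately show ?thesis
      by fastforce
  qed (auto simp: region_def split: if_splits)
  then show ?thesis
    using assms by (metis inf_commute linorder_neqE_nat)
qed

section \<open>Regions at the faces of the cube\<close>

text \<open>At \<open>p r = 0\<close> the functional \<open>crossing\<close> with index
  \<open>r div 2\<close> is a convex combination of \<open>x$1 + M\<close> and the absolute height,
  hence not negative on this side of the horizontal line.\<close>

lemma region_lower_face:
  assumes p: "p \<in> unit_cube" "p r = 0" and r: "r < 2 * k - 2" and x: "\<bar>x$1\<bar> < M"
  shows "x \<notin> region k M p r"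
proof
  define i where "i = r div 2"
  define a b H where "a = p (2 * i)" and "b = p (2 * i + 1)" and "H = height k M p x"
  assume "x \<in> region k M p r"
  moreover have "i < k - 1"
    using r by (auto simp: i_def)
  ultimately have neg: "((1 - a) * (1 - b) + a * b) * x$1 + (b - a) * H + M * (1 - a - b) < 0"
    and H: "if even r then H > 0 else H < 0"
    by (auto simp: region_def crossing_def Let_def a_def b_def H_def i_def split: if_splits)
  have ab: "0 \<le> a" "a \<le> 1" "0 \<le> b" "b \<le> 1"
    using p by (auto simp: unit_cube_def a_def b_def)
  show False
  proof (cases "even r")
    case True
    then have "a = 0"
      using p by (simp add: a_def i_def)
    then have "(1 - b) * (x$1 + M) + b * H < 0"
      using neg by (simp add: algebra_simps)
    moreover have "(1 - b) * (x$1 + M) \<ge> 0" "b * H \<ge> 0"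
      using True H ab x by auto
    ultimately show False by linarith
  next
    case False
    then have "b = 0"
      using p by (simp add: b_def i_def)
    then have "(1 - a) * (x$1 + M) + a * (- H) < 0"
      using neg by (simp add: algebra_simps)
    moreover have "(1 - a) * (x$1 + M) \<ge> 0" "a * (- H) \<ge> 0"
      using False H ab x by (auto intro: mult_nonneg_nonneg mult_nonneg_nonpos)
    ultimately show False by linarith
  qed
qed

text \<open>At \<open>p r = 1\<close> the negated functional is a convex combination of
  \<open>M - x$1\<close> and the absolute height, whereas every later region of this parity needs
  \<open>crossing\<close> positive at \<open>r div 2\<close>.\<close>

lemma region_upper_face:
  assumes p: "p \<in> unit_cube" "p r = 1" and r: "r < m" "even m = even r" and x: "\<bar>x$1\<bar> < M"
  shows "x \<notin> region k M p m"
proof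
  define i where "i = r div 2"
  define a b H where "a = p (2 * i)" and "b = p (2 * i + 1)" and "H = height k M p x"
  assume "x \<in> region k M p m"
  moreover have "i < m div 2"
    using r unfolding i_def by presburger
  ultimately have pos: "((1 - a) * (1 - b) + a * b) * x$1 + (b - a) * H + M * (1 - a - b) > 0"
    and H: "if even r then H > 0 else H < 0"
    using r by (auto simp: region_def crossing_def Let_def a_def b_def H_def split: if_splits)
  have ab: "0 \<le> a" "a \<le> 1" "0 \<le> b" "b \<le> 1"
    using p by (auto simp: unit_cube_def a_def b_def)
  show False
  proof (cases "even r")
    case True
    then have "a = 1"
      using p by (simp add: a_def i_def)
    then have "b * (M - x$1) + (1 - b) * H < 0"
      using pos by (simp add: algebra_simps)
    moreover have "b * (M - x$1) \<ge> 0" "(1 - b) * H \<ge> 0"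
      using True H ab x by auto
    ultimately show False by linarith
  next
    case False
    then have "b = 1"
      using p by (simp add: b_def i_def)
    then have "a * (M - x$1) + (1 - a) * (- H) < 0"
      using pos by (simp add: algebra_simps)
    moreover have "a * (M - x$1) \<ge> 0" "(1 - a) * (- H) \<ge> 0"
      using False H ab x by (auto intro: mult_nonneg_nonneg mult_nonneg_nonpos)
    ultimately show False by linarith
  qed
qed

section \<open>Openness of containment and covering by regions\<close>

lemma continuous_on_height:
  assumes "continuous_on S P" "continuous_on S X"
  shows "continuous_on S (\<lambda>z. height k M (P z) (X z))"
proof -
  have "continuous_on S (\<lambda>z. P z (2 * k - 2))"
    using assms(1) by (rule continuous_on_product_then_coordinatewise)
  then show ?thesis
    unfolding height_def
    by (intro continuous_on_diff continuous_on_mult continuous_on_const continuous_on_component assms(2))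
qed

lemma continuous_on_crossing:
  assumes "continuous_on S P" "continuous_on S X"
  shows "continuous_on S (\<lambda>z. crossing k M (P z) i (X z))"
proof -
  have "continuous_on S (\<lambda>z. P z m)" for m
    using assms(1) by (rule continuous_on_product_then_coordinatewise)
  then show ?thesis
    unfolding crossing_def Let_def
    by (intro continuous_on_add continuous_on_diff continuous_on_mult continuous_on_const
        continuous_on_component continuous_on_height assms)
qed

text \<open>The strict inequalities are jointly open in parameter and point; for compact
  \<open>S\<close> the tube lemma makes containment open in the parameter alone.\<close>

lemma open_subset_region:
  assumes "compact S"
  shows "open {p. S \<subseteq> region k M p r}"
proof (subst open_subopen, safe)
  fix p assume p: "S \<subseteq> region k M p r"
  have h: "continuous_on UNIV (\<lambda>z. height k M (fst z) (snd z))"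
    by (intro continuous_on_height continuous_on_fst continuous_on_snd continuous_on_id)
  have c: "continuous_on UNIV (\<lambda>z. crossing k M (fst z) m (snd z))" for m
    by (intro continuous_on_crossing continuous_on_fst continuous_on_snd continuous_on_id)
  define W where "W = {z. snd z \<in> region k M (fst z) r}"
  have "W = {z. if even r then 0 < height k M (fst z) (snd z) else height k M (fst z) (snd z) < 0} \<inter>
      (\<Inter>m\<in>{..<r div 2}. {z. 0 < crossing k M (fst z) m (snd z)}) \<inter>
      (if r div 2 < k - 1 then {z. crossing k M (fst z) (r div 2) (snd z) < 0} else UNIV)"
    by (auto simp: W_def region_def)
  also have "open \<dots>"
    using open_Collect_less[OF continuous_on_const h] open_Collect_less[OF h continuous_on_const]
      open_Collect_less[OF continuous_on_const c] open_Collect_less[OF c continuous_on_const]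
    by (cases "even r"; intro open_Int open_INT) simp_all
  finally have "open W" .
  moreover have "{p} \<times> S \<subseteq> W"
    using p by (auto simp: W_def)
  ultimately obtain X where X: "p \<in> X" "open X" "X \<times> S \<subseteq> W"
    using Elementary_Topology.tube_lemma[OF assms] by metis
  then have "X \<subseteq> {p. S \<subseteq> region k M p r}"
    by (auto simp: W_def)
  then show "\<exists>T. open T \<and> p \<in> T \<and> T \<subseteq> {p. S \<subseteq> region k M p r}"
    using X by blast
qed

lemma convex_subset_region:
  assumes k: "k \<ge> 1" and S: "convex S" "\<And>x. x \<in> S \<Longrightarrow> height k M p x \<noteq> 0"
    "\<And>i x. i < k - 1 \<Longrightarrow> x \<in> S \<Longrightarrow> crossing k M p i x \<noteq> 0"
  shows "\<exists>r<2 * k. S \<subseteq> region k M p r"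
proof -
  \<comment> \<open>The first crossing line with \<open>S\<close> on its negative side, with default
    \<open>k - 1\<close> if there is none. By \<open>convex_nonzero_sign\<close>, \<open>S\<close>
    is on the positive side of all earlier lines.\<close>
  define i where "i = (LEAST i. i = k - 1 \<or> (\<forall>x\<in>S. crossing k M p i x < 0))"
  have i: "i = k - 1 \<or> (\<forall>x\<in>S. crossing k M p i x < 0)"
    unfolding i_def by (rule LeastI[of _ "k - 1"]) simp
  have i_le: "i \<le> k - 1"
    unfolding i_def by (rule Least_le) simp
  have before: "\<forall>x\<in>S. crossing k M p m x > 0" if "m < i" for m
  proof -
    have "\<not> (\<forall>x\<in>S. crossing k M p m x < 0)"
      using not_less_Least[of m] that unfolding i_def by blast
    moreover have "m < k - 1"
      using that i_le by linarith
    ultimately show ?thesis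
      using convex_nonzero_sign[OF S(1), of "crossing k M p m"] S(3)
        continuous_on_crossing[OF continuous_on_const continuous_on_id, of S]
      by blast
  qed
  have "(\<forall>x\<in>S. height k M p x < 0) \<or> (\<forall>x\<in>S. height k M p x > 0)"
    using convex_nonzero_sign[OF S(1), of "height k M p"] S(2)
      continuous_on_height[OF continuous_on_const continuous_on_id, of S]
    by blast
  then show ?thesis
  proof
    assume "\<forall>x\<in>S. height k M p x < 0"
    then have "S \<subseteq> region k M p (2 * i + 1)"
      using i before by (auto simp: region_def)
    then show ?thesis
      using i_le k by (intro exI[of _ "2 * i + 1"]) auto
  next
    assume "\<forall>x\<in>S. height k M p x > 0"
    then have "S \<subseteq> region k M p (2 * i)"
      using i before by (auto simp: region_def)
    then show ?thesis
      using i_le k by (intro exI[of _ "2 * i"]) auto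
  qed
qed

text \<open>Some member misses all the lines of the configuration and, being convex, stays in one
  region. The lines may coincide, so only \<open>card \<L> \<le> k\<close> is available.\<close>

lemma missed_by_region_lines:
  assumes "k \<ge> 1" "\<not> pierced_by_lines k \<G>" "\<And>S. S \<in> \<G> \<Longrightarrow> convex S"
  shows "\<exists>r<2 * k. \<exists>S\<in>\<G>. S \<subseteq> region k M p r"
proof -
  define \<L> where "\<L> = insert {x. height k M p x = 0} ((\<lambda>i. {x. crossing k M p i x = 0}) ` {..<k - 1})"
  have "card \<L> \<le> Suc (k - 1)"
    unfolding \<L>_def by (rule order_trans[OF card_insert_le_m1]) (auto intro: card_image_le[THEN order_trans])
  then have "finite \<L>" "card \<L> \<le> k" "\<And>L. L \<in> \<L> \<Longrightarrow> is_line L"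
    using assms(1) is_line_height is_line_crossing by (auto simp: \<L>_def)
  then obtain S where S: "S \<in> \<G>" "\<Union>\<L> \<inter> S = {}"
    using assms(2) pierced_by_at_most_lines by metis
  then have "\<exists>r<2 * k. S \<subseteq> region k M p r"
    using assms by (intro convex_subset_region) (auto simp: \<L>_def)
  then show ?thesis
    using S by blast
qed

section \<open>Selecting disjoint sets from unpierced families\<close>

lemma rainbow_disjoint_nonempty:
  fixes \<G> :: "nat \<Rightarrow> (real^2) set set"
  assumes k: "k \<ge> 1" and fin: "\<And>j. j < 2 * k \<Longrightarrow> finite (\<G> j)"
    and sets: "\<And>j S. j < 2 * k \<Longrightarrow> S \<in> \<G> j \<Longrightarrow> compact S \<and> convex S \<and> S \<noteq> {}"
    and npierced: "\<And>j. j < 2 * k \<Longrightarrow> \<not> pierced_by_lines k (\<G> j)"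
  shows "\<exists>F. (\<forall>j<2 * k. F j \<in> \<G> j) \<and> (\<forall>i<2 * k. \<forall>j<2 * k. i \<noteq> j \<longrightarrow> F i \<inter> F j = {})"
proof -
  have "bounded (\<Union>j<2 * k. \<Union>(\<G> j))"
    using fin sets by (intro bounded_UN bounded_Union finite_lessThan ballI) (auto intro: compact_imp_bounded)
  then obtain M where M: "\<And>x. x \<in> (\<Union>j<2 * k. \<Union>(\<G> j)) \<Longrightarrow> norm x < M"
    by (metis bounded_pos_less)
  have box: "\<bar>x$1\<bar> < M" "\<bar>x$2\<bar> < M" if "x \<in> S" "S \<in> \<G> j" "j < 2 * k" for x S j
    using M[of x] that component_le_norm_cart[of x 1] component_le_norm_cart[of x 2] by force+
  define A where "A j r = {p. \<exists>S\<in>\<G> j. S \<subseteq> region k M p r}" for j r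
  \<comment> \<open>Every member is nonempty and lies in the open square of half-width
    \<open>M\<close>, so no member fits in a region that misses the square.\<close>
  have avoid: "p \<notin> A j r"
    if "j < 2 * k" "\<And>x. \<bar>x$1\<bar> < M \<Longrightarrow> \<bar>x$2\<bar> < M \<Longrightarrow> x \<notin> region k M p r" for p j r
    using that sets box unfolding A_def by blast
  have "\<exists>p\<in>unit_cube. \<exists>\<pi>. inj_on \<pi> {..<2 * k} \<and> (\<forall>j<2 * k. \<pi> j < 2 * k \<and> p \<in> A j (\<pi> j))"
  proof (rule rainbow_cover_unit_cube[OF k])
    show "open (A j r)" if "j < 2 * k" for j r
    proof -
      have "A j r = (\<Union>S\<in>\<G> j. {p. S \<subseteq> region k M p r})"
        by (auto simp: A_def)
      then show ?thesis
        using open_subset_region sets that by auto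
    qed
    show "\<exists>r<2 * k. p \<in> A j r" if "j < 2 * k" for j p
      using missed_by_region_lines[OF k npierced] sets that by (simp add: A_def)
    show "p \<notin> A j r" if "j < 2 * k" "r < 2 * k - 2" "p \<in> unit_cube" "p r = 0" for j r p
      using that by (intro avoid region_lower_face)
    show "p \<notin> A j m" if "j < 2 * k" "p \<in> unit_cube" "p r = 1" "r < m" "even m = even r" for j r m p
      using that by (intro avoid region_upper_face)
    \<comment> \<open>Here the horizontal line is at level \<open>- M\<close>, with the whole square
      above it; at the opposite face it is at level \<open>M\<close>.\<close>
    show "p \<notin> A j r" if "j < 2 * k" "p (2 * k - 2) = 0" "odd r" for j r p
      using that by (intro avoid) (auto simp: region_def height_def)
    show "p \<notin> A j r" if "j < 2 * k" "p (2 * k - 2) = 1" "even r" for j r p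
      using that by (intro avoid) (auto simp: region_def height_def)
  qed
  then obtain p \<pi> where \<pi>: "inj_on \<pi> {..<2 * k}" "\<And>j. j < 2 * k \<Longrightarrow> \<pi> j < 2 * k"
    and "\<And>j. j < 2 * k \<Longrightarrow> p \<in> A j (\<pi> j)"
    by blast
  then have "\<exists>S\<in>\<G> j. S \<subseteq> region k M p (\<pi> j)" if "j < 2 * k" for j
    using that by (simp add: A_def)
  then obtain F where F: "\<And>j. j < 2 * k \<Longrightarrow> F j \<in> \<G> j \<and> F j \<subseteq> region k M p (\<pi> j)"
    by metis
  have "F i \<inter> F j = {}" if "i < 2 * k" "j < 2 * k" "i \<noteq> j" for i j
  proof -
    have "\<pi> i \<noteq> \<pi> j"
      using \<pi>(1) that by (auto dest: inj_onD)
    then have "region k M p (\<pi> i) \<inter> region k M p (\<pi> j) = {}"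
      using \<pi>(2) that by (intro disjoint_regions) auto
    then show ?thesis
      using F that by blast
  qed
  then show ?thesis
    using F by blast
qed

text \<open>The faces of the cube only work for nonempty sets, so a family containing the empty set is
  traded for another one; its own contribution to the selection is the empty set.\<close>

lemma rainbow_disjoint:
  fixes \<G> :: "nat \<Rightarrow> (real^2) set set"
  assumes k: "k \<ge> 1" and fin: "\<And>j. j < 2 * k \<Longrightarrow> finite (\<G> j)"
    and sets: "\<And>j S. j < 2 * k \<Longrightarrow> S \<in> \<G> j \<Longrightarrow> compact S \<and> convex S"
    and npierced: "\<And>j. j < 2 * k \<Longrightarrow> \<not> pierced_by_lines k (\<G> j)"
  shows "\<exists>F. (\<forall>j<2 * k. F j \<in> \<G> j) \<and> (\<forall>i<2 * k. \<forall>j<2 * k. i \<noteq> j \<longrightarrow> F i \<inter> F j = {})"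
proof (cases "\<forall>j<2 * k. {} \<in> \<G> j")
  case True
  then show ?thesis
    by (intro exI[of _ "\<lambda>_. {}"]) auto
next
  case False
  then obtain j0 where j0: "j0 < 2 * k" "{} \<notin> \<G> j0"
    by blast
  \<comment> \<open>Several indices may be sent to \<open>j0\<close>; the families in the nonempty
    case are allowed to coincide.\<close>
  define c where "c j = (if {} \<in> \<G> j then j0 else j)" for j
  have c: "c j < 2 * k" "{} \<notin> \<G> (c j)" if "j < 2 * k" for j
    using that j0 by (auto simp: c_def)
  have "\<exists>F. (\<forall>j<2 * k. F j \<in> \<G> (c j)) \<and> (\<forall>i<2 * k. \<forall>j<2 * k. i \<noteq> j \<longrightarrow> F i \<inter> F j = {})"
    using c fin sets npierced by (intro rainbow_disjoint_nonempty[OF k]) metis+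
  then obtain F where F: "\<forall>j<2 * k. F j \<in> \<G> (c j)"
    "\<forall>i<2 * k. \<forall>j<2 * k. i \<noteq> j \<longrightarrow> F i \<inter> F j = {}"
    by blast
  then show ?thesis
    by (intro exI[of _ "\<lambda>j. if {} \<in> \<G> j then {} else F j"]) (auto simp: c_def)
qed

theorem theorem1p3:
  fixes k :: nat and \<F> :: "nat \<Rightarrow> (real ^ 2) set set"
  assumes "k \<ge> 1"
    and "\<And>i. i \<in> {1..2 * k} \<Longrightarrow> finite (\<F> i)"
    and "\<And>i S. i \<in> {1..2 * k} \<Longrightarrow> S \<in> \<F> i \<Longrightarrow> compact S \<and> convex S"
    and "\<And>F. (\<forall>i\<in>{1..2 * k}. F i \<in> \<F> i) \<Longrightarrow>
           \<exists>i\<in>{1..2 * k}. \<exists>j\<in>{1..2 * k}. i \<noteq> j \<and> F i \<inter> F j \<noteq> {}"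
  shows "\<exists>i\<in>{1..2 * k}. pierced_by_lines k (\<F> i)"
proof (rule ccontr)
  assume np: "\<not> ?thesis"
  \<comment> \<open>The families are renumbered from 0, to match the numbering of the
    regions.\<close>
  have "\<exists>F. (\<forall>j<2 * k. F j \<in> \<F> (Suc j)) \<and> (\<forall>i<2 * k. \<forall>j<2 * k. i \<noteq> j \<longrightarrow> F i \<inter> F j = {})"
  proof (rule rainbow_disjoint[OF assms(1)])
    fix j S assume "j < 2 * k"
    then have j: "Suc j \<in> {1..2 * k}"
      by simp
    show "finite (\<F> (Suc j))" "\<not> pierced_by_lines k (\<F> (Suc j))"
      using assms(2)[OF j] np j by blast+
    show "compact S \<and> convex S" if "S \<in> \<F> (Suc j)"
      using assms(3)[OF j that] .
  qed
  then obtain F where F: "\<And>j. j < 2 * k \<Longrightarrow> F j \<in> \<F> (Suc j)"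
    and disj: "\<And>i j. i < 2 * k \<Longrightarrow> j < 2 * k \<Longrightarrow> i \<noteq> j \<Longrightarrow> F i \<inter> F j = {}"
    by blast
  have idx: "i - 1 < 2 * k" "Suc (i - 1) = i" if "i \<in> {1..2 * k}" for i
    using that by auto
  have "\<forall>i\<in>{1..2 * k}. F (i - 1) \<in> \<F> i"
    using F idx by metis
  then obtain i j where ij: "i \<in> {1..2 * k}" "j \<in> {1..2 * k}" "i \<noteq> j" "F (i - 1) \<inter> F (j - 1) \<noteq> {}"
    using assms(4)[of "\<lambda>i. F (i - 1)"] by blast
  then show False
    using disj[of "i - 1" "j - 1"] idx by metis
qed

end
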